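(* Let $\Gamma$ be a finitely generated group which has an infinite soluble normal subgroup. Then $\mathrm{RG}(\Gamma,(\Gamma_n))=0$ for every chain $(\Gamma_n)$ in $\Gamma$ with $\bigcap_n\Gamma_n=\{1\}$.
   Context: A chain in $\Gamma$ is a decreasing infinite sequence $\Gamma=\Gamma_0>\Gamma_1>\cdots$ of finite index subgroups (not necessarily normal). With $d(H)$ the minimal number of generators of $H$, $r(\Gamma,H)=(d(H)-1)/|\Gamma:H|$ and the rank gradient is $\mathrm{RG}(\Gamma,(\Gamma_n))=\lim_n r(\Gamma,\Gamma_n)$. *)

theory Defs
  imports "HOL-Analysis.Analysis" "HOL-Algebra.Algebra"
begin

definition min_gens :: "('a, 'b) monoid_scheme \<Rightarrow> 'a set \<Rightarrow> nat" where
  "min_gens G H = (LEAST k. \<exists>S. finite S \<and> S \<subseteq> H \<and> generate G S = H \<and> card S = k)"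

definition fin_generated :: "('a, 'b) monoid_scheme \<Rightarrow> bool" where
  "fin_generated G \<longleftrightarrow> (\<exists>S. finite S \<and> S \<subseteq> carrier G \<and> generate G S = carrier G)"

definition index :: "('a, 'b) monoid_scheme \<Rightarrow> 'a set \<Rightarrow> nat" where
  "index G H = card (rcosets\<^bsub>G\<^esub> H)"

definition is_chain :: "('a, 'b) monoid_scheme \<Rightarrow> (nat \<Rightarrow> 'a set) \<Rightarrow> bool" where
  "is_chain G \<Gamma> \<longleftrightarrow> \<Gamma> 0 = carrier G \<and>
     (\<forall>n. subgroup (\<Gamma> n) G \<and> finite (rcosets\<^bsub>G\<^esub> (\<Gamma> n))) \<and>
     (\<forall>n. \<Gamma> (Suc n) \<subset> \<Gamma> n)"

definition rank_ratio :: "('a, 'b) monoid_scheme \<Rightarrow> 'a set \<Rightarrow> real" where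
  "rank_ratio G H = (real (min_gens G H) - 1) / real (index G H)"

end

theory Submission
  imports Defs "HOL-Real_Asymp.Real_Asymp"
begin

text \<open>
  Residual finiteness turns the last infinite term of the derived series of the soluble normal
  subgroup, cut with the normal core of some \<open>\<Gamma>\<^sub>n\<close>, into an infinite abelian normal subgroup \<open>A\<close>.
  Let \<open>H = \<Gamma>\<^sub>n\<close> and \<open>m = |A : A \<inter> H|\<close>, which tends to infinity. By Schreier, \<open>AH\<close> has
  \<open>O(|\<Gamma> : AH|)\<close> generators. Since \<open>A\<close> is abelian, \<open>H\<close> is generated by the \<open>H\<close>-parts of these,
  boundedly many corrections for each pair of such a part and one of at most \<open>log\<^sub>2 m\<close>
  generators of \<open>A\<close> modulo \<open>A \<inter> H\<close>, and at most \<open>log\<^sub>2 m\<close> further elements. As \<open>|\<Gamma> : H| = m |\<Gamma> : AH|\<close>, the ratio is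
  \<open>O(log m / m)\<close>.
\<close>

section \<open>Right cosets, the index and Schreier generators\<close>

context group begin

lemma r_coset_eq_iff:
  assumes "subgroup H G" "x \<in> carrier G" "y \<in> carrier G"
  shows "H #> x = H #> y \<longleftrightarrow> x \<otimes> inv y \<in> H"
proof
  assume "H #> x = H #> y"
  then have "x \<in> H #> y"
    using rcos_self[OF assms(2,1)] by simp
  then show "x \<otimes> inv y \<in> H"
    using subgroup.rcos_module_imp[OF assms(1) is_group assms(3)] by simp
next
  assume "x \<otimes> inv y \<in> H"
  then have "x \<in> H #> y"
    using subgroup.rcos_module_rev[OF assms(1) is_group assms(3,2)] by simp
  then show "H #> x = H #> y"
    using repr_independence[OF _ assms(3,1)] by simp
qed

text \<open>With a representative \<open>r C\<close> fixed for every coset \<open>C\<close> of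
  \<open>K\<close>, each coset of \<open>H\<close> is in exactly one way a coset inside
  \<open>K\<close> translated by some \<open>r C\<close>. The count covers infinite sets too, where
  \<open>card\<close> is 0, so a positive left-hand side later forces both factors to be
  finite.\<close>

lemma index_mult:
  assumes H: "subgroup H G" and K: "subgroup K G" and "H \<subseteq> K"
  shows "index G H = index G K * card ((\<lambda>x. H #> x) ` K)"
proof -
  define r where "r C = (SOME x. x \<in> C)" for C :: "'a set"
  have Kc: "K \<subseteq> carrier G" and Hc: "H \<subseteq> carrier G"
    using K H subgroup.subset by auto
  have r: "r (K #> x) \<in> K #> x" if "x \<in> carrier G" for x
    unfolding r_def using rcos_self[OF that K] by (rule someI)
  have rc: "r (K #> x) \<in> carrier G" if "x \<in> carrier G" for x
    using r[OF that] r_coset_subset_G[OF Kc that] by blast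
  have Kr: "K #> r (K #> x) = K #> x" if "x \<in> carrier G" for x
    using repr_independence[OF r[OF that] that K] by simp
  have "bij_betw (\<lambda>(C, D). D #> r C) ((rcosets K) \<times> (\<lambda>x. H #> x) ` K) (rcosets H)"
    unfolding bij_betw_def
  proof
    show "inj_on (\<lambda>(C, D). D #> r C) ((rcosets K) \<times> (\<lambda>x. H #> x) ` K)"
    proof (rule inj_onI, clarsimp simp: RCOSETS_def)
      fix x y k l
      assume xy: "x \<in> carrier G" "y \<in> carrier G" and kl: "k \<in> K" "l \<in> K"
        and eq: "(H #> k) #> r (K #> x) = (H #> l) #> r (K #> y)"
      let ?u = "r (K #> x)" and ?v = "r (K #> y)"
      have c: "k \<in> carrier G" "l \<in> carrier G" "?u \<in> carrier G" "?v \<in> carrier G"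
        using kl Kc xy rc by auto
      have "H #> (k \<otimes> ?u) = H #> (l \<otimes> ?v)"
        using eq c Hc by (simp add: coset_mult_assoc)
      then have *: "(k \<otimes> ?u) \<otimes> inv (l \<otimes> ?v) \<in> H"
        using c H by (simp add: r_coset_eq_iff)
      then have "inv k \<otimes> ((k \<otimes> ?u) \<otimes> inv (l \<otimes> ?v)) \<otimes> l \<in> K"
        using kl \<open>H \<subseteq> K\<close> by (meson K subgroup.m_closed subgroup.m_inv_closed subsetD)
      moreover have "inv k \<otimes> ((k \<otimes> ?u) \<otimes> inv (l \<otimes> ?v)) \<otimes> l = ?u \<otimes> inv ?v"
        using c by (simp add: m_assoc inv_mult_group inv_solve_left')
      ultimately have "K #> ?u = K #> ?v"
        using c K by (simp add: r_coset_eq_iff)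
      then have xy': "K #> x = K #> y" using Kr xy by simp
      have "(k \<otimes> ?u) \<otimes> inv (l \<otimes> ?u) = k \<otimes> inv l"
        using c by (simp add: m_assoc inv_mult_group) (simp add: m_assoc[symmetric])
      then have "H #> k = H #> l"
        using * xy' c H by (simp add: r_coset_eq_iff)
      with xy' show "K #> x = K #> y \<and> H #> k = H #> l" by simp
    qed
    show "(\<lambda>(C, D). D #> r C) ` ((rcosets K) \<times> (\<lambda>x. H #> x) ` K) = rcosets H"
    proof (intro equalityI subsetI)
      fix D assume "D \<in> (\<lambda>(C, D). D #> r C) ` ((rcosets K) \<times> (\<lambda>x. H #> x) ` K)"
      then obtain x k where "x \<in> carrier G" "k \<in> carrier G" "D = (H #> k) #> r (K #> x)"
        using Kc by (auto simp: RCOSETS_def)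
      then show "D \<in> rcosets H"
        using Hc rc by (simp add: coset_mult_assoc rcosetsI)
    next
      fix D assume "D \<in> rcosets H"
      then obtain x where x: "x \<in> carrier G" "D = H #> x"
        by (auto simp: RCOSETS_def)
      let ?k = "x \<otimes> inv r (K #> x)"
      have "?k \<in> K"
        using Kr[OF x(1)] r_coset_eq_iff[OF K x(1) rc[OF x(1)]] by simp
      moreover have "D = (H #> ?k) #> r (K #> x)"
        using x rc[OF x(1)] Hc by (simp add: coset_mult_assoc m_assoc)
      ultimately show "D \<in> (\<lambda>(C, D). D #> r C) ` ((rcosets K) \<times> (\<lambda>x. H #> x) ` K)"
        using x Kc by (intro image_eqI[of _ _ "(K #> x, H #> ?k)"]) (auto intro: rcosetsI)
    qed
  qed
  then show ?thesis
    unfolding index_def by (metis bij_betw_same_card card_cartesian_product)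
qed

text \<open>Schreier's argument: \<open>K\<close> is generated by the elements that correct t y to
  the representative of its coset, for t in a transversal and y a generator or the inverse of one.
  Admitting inverses makes the stability argument a plain induction and costs the factor 2.\<close>

lemma schreier_generators:
  assumes K: "subgroup K G" and fin: "finite (rcosets K)"
    and Y: "finite Y" "Y \<subseteq> carrier G" "generate G Y = carrier G"
  obtains S where "finite S" "S \<subseteq> K" "generate G S = K" "card S \<le> 2 * card Y * index G K"
proof -
  \<comment> \<open>The coset \<open>K\<close> itself is represented by \<one>. At the end this
    makes the only representative lying in \<open>K\<close> trivial, so that an element h t of
    \<open>K\<close> is just h.\<close>
  define r where "r C = (if C = K then \<one> else SOME x. x \<in> C)" for C :: "'a set"
  define Z where "Z = Y \<union> (\<lambda>x. inv x) ` Y"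
  define R where "R = r ` (rcosets K)"
  define s where "s = (\<lambda>(t, y). t \<otimes> y \<otimes> inv r (K #> (t \<otimes> y)))"
  define S where "S = s ` (R \<times> Z)"
  have Kc: "K \<subseteq> carrier G" using K subgroup.subset by auto
  have Zc: "Z \<subseteq> carrier G" using Y by (auto simp: Z_def)
  have r: "r (K #> x) \<in> K #> x" if "x \<in> carrier G" for x
    using rcos_self[OF that K] someI[of "\<lambda>z. z \<in> K #> x"] subgroup.one_closed[OF K]
    by (auto simp: r_def)
  have rc: "r (K #> x) \<in> carrier G" if "x \<in> carrier G" for x
    using r[OF that] r_coset_subset_G[OF Kc that] by blast
  have Kr: "K #> r (K #> x) = K #> x" if "x \<in> carrier G" for x
    using repr_independence[OF r[OF that] that K] by simp
  have rR: "r (K #> x) \<in> R" if "x \<in> carrier G" for x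
    unfolding R_def using that Kc by (auto intro: rcosetsI)
  have Rc: "R \<subseteq> carrier G" unfolding R_def RCOSETS_def using rc by auto
  have sK: "s (t, y) \<in> K" if "t \<in> R" "y \<in> Z" for t y
  proof -
    have "t \<otimes> y \<in> carrier G" using that Rc Zc by auto
    then show ?thesis
      using Kr[of "t \<otimes> y"] r_coset_eq_iff[OF K, of "t \<otimes> y" "r (K #> (t \<otimes> y))"] rc
      by (simp add: s_def)
  qed
  have SK: "S \<subseteq> K" unfolding S_def using sK by auto
  have gS: "generate G S \<subseteq> K" using generate_subgroup_incl[OF SK K] .
  have Sc: "S \<subseteq> carrier G" using SK Kc by auto
  \<comment> \<open>The aim is that \<open>P\<close> is the whole group. It contains \<one>, and
    right multiplication by y moves t to the representative of its new coset, while the difference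
    \<open>s (t, y)\<close> is absorbed by the left factor.\<close>
  define P where "P = {h \<otimes> t | h t. h \<in> generate G S \<and> t \<in> R}"
  have step: "p \<otimes> y \<in> P" if p: "p \<in> P" and y: "y \<in> Z" for p y
  proof -
    obtain h t where ht: "h \<in> generate G S" "t \<in> R" "p = h \<otimes> t"
      using p P_def by auto
    have c: "h \<in> carrier G" "t \<in> carrier G" "y \<in> carrier G"
      using ht y Rc Zc generate_in_carrier[OF Sc] by auto
    have "p \<otimes> y = (h \<otimes> s (t, y)) \<otimes> r (K #> (t \<otimes> y))"
      using c rc[of "t \<otimes> y"] ht by (simp add: s_def m_assoc)
    moreover have "h \<otimes> s (t, y) \<in> generate G S"
      using ht y by (auto simp: S_def intro!: generate.eng[OF _ generate.incl])
    ultimately show ?thesis using rR c unfolding P_def by blast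
  qed
  have Pc: "P \<subseteq> carrier G" unfolding P_def using Rc generate_in_carrier[OF Sc] by auto
  have "\<forall>p\<in>P. p \<otimes> g \<in> P" if "g \<in> generate G Y" for g
    using that
  proof induction
    case one
    then show ?case using Pc by auto
  next
    case (incl h)
    then show ?case using step by (auto simp: Z_def)
  next
    case (inv h)
    then show ?case using step by (auto simp: Z_def)
  next
    case (eng h1 h2)
    show ?case
    proof
      fix p assume p: "p \<in> P"
      then have "(p \<otimes> h1) \<otimes> h2 \<in> P" using eng by auto
      moreover have "(p \<otimes> h1) \<otimes> h2 = p \<otimes> (h1 \<otimes> h2)"
        using p Pc eng(1,2) Y(3) by (intro m_assoc) auto
      ultimately show "p \<otimes> (h1 \<otimes> h2) \<in> P" by simp
    qed
  qed
  moreover have rK: "r K = \<one>" by (simp add: r_def)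
  moreover have "\<one> \<in> P"
  proof -
    have "\<one> \<in> R" using rR[OF one_closed] rK coset_mult_one[OF Kc] by simp
    then have "\<one> \<otimes> \<one> \<in> P" unfolding P_def using generate.one[of G S] by blast
    then show ?thesis by simp
  qed
  ultimately have P: "carrier G \<subseteq> P" using Y(3) by fastforce
  have "K \<subseteq> generate G S"
  proof
    fix k assume k: "k \<in> K"
    then obtain h t where ht: "h \<in> generate G S" "t \<in> R" "k = h \<otimes> t"
      using P Kc P_def by auto
    have c: "h \<in> carrier G" "t \<in> carrier G" using ht Rc generate_in_carrier[OF Sc] by auto
    have "inv h \<otimes> k \<in> K"
      using gS ht(1) k K by (auto intro!: subgroup.m_closed subgroup.m_inv_closed)
    then have "t \<in> K" using c ht by (simp add: m_assoc[symmetric])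
    obtain x where x: "x \<in> carrier G" "t = r (K #> x)"
      using ht(2) by (auto simp: R_def RCOSETS_def)
    have "K #> x = K" using Kr[OF x(1)] x(2) \<open>t \<in> K\<close> coset_join2[OF c(2) K] by simp
    then have "t = \<one>" using x rK by simp
    then show "k \<in> generate G S" using ht c by simp
  qed
  moreover have "finite S" unfolding S_def R_def Z_def using fin Y by auto
  moreover have "card S \<le> 2 * card Y * index G K"
  proof -
    have finRZ: "finite R" "finite Z" using fin Y by (auto simp: R_def Z_def)
    have "card S \<le> card (R \<times> Z)"
      unfolding S_def by (rule card_image_le) (simp add: finRZ)
    also have "\<dots> = card R * card Z" by (rule card_cartesian_product)
    also have "\<dots> \<le> index G K * (card Y + card Y)"
      unfolding index_def R_def Z_def
      using card_image_le[OF fin, of r] card_image_le[OF Y(1), of "m_inv G"] card_Un_le[of Y "m_inv G ` Y"]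
      by (intro mult_le_mono) auto
    finally show ?thesis by (simp add: algebra_simps)
  qed
  ultimately show ?thesis using that SK gS by blast
qed

end

section \<open>Generators of subgroups and quotients of abelian groups\<close>

context comm_group begin

lemma generate_insertE:
  assumes "T \<subseteq> carrier G" "b \<in> carrier G" "x \<in> generate G (insert b T)"
  obtains k :: int and t where "t \<in> generate G T" "x = b [^] k \<otimes> t"
proof -
  have gc: "t \<in> carrier G" if "t \<in> generate G T" for t
    using that generate_in_carrier[OF assms(1)] by simp
  from assms(3) have "\<exists>k::int. \<exists>t\<in>generate G T. x = b [^] k \<otimes> t"
  proof induction
    case one
    show ?case
      by (intro exI[of _ 0] bexI[OF _ generate.one]) simp
  next
    case (incl h)
    then show ?case
    proof
      assume "h = b"
      then show ?thesis
        using assms(2) by (intro exI[of _ 1] bexI[OF _ generate.one]) (simp add: int_pow_1)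
    next
      assume "h \<in> T"
      then show ?thesis
        using assms(1) by (intro exI[of _ 0] bexI[of _ h] generate.incl) auto
    qed
  next
    case (inv h)
    then show ?case
    proof
      assume "h = b"
      then show ?thesis
        using assms(2) by (intro exI[of _ "-1"] bexI[OF _ generate.one]) (simp add: int_pow_neg int_pow_1)
    next
      assume "h \<in> T"
      then show ?thesis
        using assms(1) by (intro exI[of _ 0] bexI[of _ "inv h"] generate.inv) auto
    qed
  next
    case (eng g h)
    then obtain k l :: int and t u where *:
      "t \<in> generate G T" "g = b [^] k \<otimes> t" "u \<in> generate G T" "h = b [^] l \<otimes> u"
      by blast
    then have "g \<otimes> h = b [^] (k + l) \<otimes> (t \<otimes> u)"
      using assms(2) gc by (simp add: int_pow_mult m_ac)
    then show ?case using generate.eng[OF *(1,3)] by blast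
  qed
  then show ?thesis using that by blast
qed

text \<open>Induction on \<open>T\<close>, as for subgroups of free abelian groups: the elements of
  \<open>L\<close> with exponent 0 at the new generator are covered by the induction hypothesis, and
  one further element that realises the least positive exponent accounts for the rest.\<close>

lemma subgroup_generators_le:
  assumes "finite T" "T \<subseteq> carrier G" "subgroup L G" "L \<subseteq> generate G T"
  shows "\<exists>U. finite U \<and> U \<subseteq> L \<and> generate G U = L \<and> card U \<le> card T"
  using assms
proof (induction T arbitrary: L rule: finite_induct)
  case empty
  then have "L = {\<one>}" using generate_empty subgroup.one_closed by blast
  then show ?case using generate_empty by (intro exI[of _ "{}"]) auto
next
  case (insert b T)
  have Tc: "T \<subseteq> carrier G" and b: "b \<in> carrier G" using insert.prems by auto
  let ?B = "generate G T"
  have B: "subgroup ?B G" using generate_is_subgroup[OF Tc] .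
  note L = insert.prems(2)
  note Lc = subgroup.mem_carrier[OF L] and Bc = subgroup.mem_carrier[OF B]
  obtain U where U: "finite U" "U \<subseteq> L \<inter> ?B" "generate G U = L \<inter> ?B" "card U \<le> card T"
    using insert.IH[OF Tc subgroups_Inter_pair[OF L B]] by blast
  \<comment> \<open>The exponent of \<open>b\<close> need not be unique, since a nontrivial power of
    \<open>b\<close> may lie in \<open>?B\<close>. Hence \<open>D\<close> collects every exponent
    that occurs in some decomposition of an element of \<open>L\<close>.\<close>
  define D where "D = {k::int. \<exists>t\<in>?B. b [^] k \<otimes> t \<in> L}"
  have decomp: "\<exists>k\<in>D. \<exists>t\<in>?B. x = b [^] k \<otimes> t" if x: "x \<in> L" for x
  proof -
    have "x \<in> generate G (insert b T)" using x insert.prems(3) by blast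
    then obtain k :: int and t where "t \<in> ?B" "x = b [^] k \<otimes> t"
      by (rule generate_insertE[OF Tc b])
    then show ?thesis using x unfolding D_def by blast
  qed
  have neg: "- k \<in> D" if k: "k \<in> D" for k
  proof -
    obtain t where t: "t \<in> ?B" "b [^] k \<otimes> t \<in> L" using k D_def by auto
    have "inv (b [^] k \<otimes> t) = b [^] (- k) \<otimes> inv t"
      using b Bc[OF t(1)] by (simp add: int_pow_neg inv_mult)
    then show ?thesis
      using subgroup.m_inv_closed[OF L t(2)] subgroup.m_inv_closed[OF B t(1)]
      unfolding D_def by auto
  qed
  show ?case
  proof (cases "\<exists>k\<in>D. k \<noteq> 0")
    case False
    have "L \<subseteq> ?B"
    proof
      fix x assume "x \<in> L"
      then obtain k t where "k \<in> D" "t \<in> ?B" "x = b [^] k \<otimes> t"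
        using decomp by blast
      moreover from this have "k = 0" using False by blast
      ultimately show "x \<in> ?B" using Bc[of t] by simp
    qed
    then have "L \<inter> ?B = L" by blast
    then show ?thesis
      using U insert.hyps by (intro exI[of _ U]) auto
  next
    case True
    then obtain k where "k \<in> D" "k \<noteq> 0" by blast
    then have "\<exists>n::nat. 0 < n \<and> int n \<in> D"
      using neg by (intro exI[of _ "nat \<bar>k\<bar>"]) (auto simp: abs_if)
    define d where "d = (LEAST n::nat. 0 < n \<and> int n \<in> D)"
    have d: "0 < d" "int d \<in> D"
      using LeastI_ex[OF \<open>\<exists>n::nat. 0 < n \<and> int n \<in> D\<close>] by (auto simp: d_def)
    have least: "d \<le> n" if "0 < n" "int n \<in> D" for n
      unfolding d_def using that by (intro Least_le) simp
    obtain t0 where t0: "t0 \<in> ?B" "b [^] int d \<otimes> t0 \<in> L" using d D_def by auto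
    let ?c = "b [^] int d \<otimes> t0"
    have LU: "insert ?c U \<subseteq> L" using t0 U by auto
    have Uc: "insert ?c U \<subseteq> carrier G" using LU Lc by blast
    have "L \<subseteq> generate G (insert ?c U)"
    proof
      fix x assume x: "x \<in> L"
      then obtain k t where k: "k \<in> D" "t \<in> ?B" "x = b [^] k \<otimes> t"
        using decomp by blast
      \<comment> \<open>Division with remainder: removing the power \<open>?q\<close> of
        \<open>?c\<close> leaves an element of \<open>L\<close> with exponent
        \<open>k mod int d\<close>. Minimality of \<open>d\<close> makes this remainder 0, which
        puts \<open>?y\<close> into \<open>?B\<close>.\<close>
      let ?q = "k div int d" and ?r = "k mod int d"
      let ?y = "x \<otimes> inv (?c [^] ?q)"
      have cq: "?c [^] ?q \<in> L" "?c [^] ?q \<in> generate G (insert ?c U)"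
        using t0(2) subgroup_int_pow_closed[OF L]
          subgroup_int_pow_closed[OF generate_is_subgroup[OF Uc] generate.incl] by auto
      have y: "?y \<in> L" using x cq L by (simp add: subgroup.m_closed subgroup.m_inv_closed)
      have ts: "t \<otimes> inv (t0 [^] ?q) \<in> ?B"
        using k t0 B subgroup_int_pow_closed[OF B] by (simp add: subgroup.m_closed subgroup.m_inv_closed)
      have tc: "t0 \<in> carrier G" "t \<in> carrier G" using Bc t0 k by auto
      have cancel: "(u \<otimes> w \<otimes> t) \<otimes> inv (w \<otimes> v) = u \<otimes> (t \<otimes> inv v)"
        if "u \<in> carrier G" "w \<in> carrier G" "v \<in> carrier G" for u w v
      proof -
        have "(u \<otimes> w \<otimes> t) \<otimes> inv (w \<otimes> v) = (u \<otimes> (t \<otimes> inv v)) \<otimes> (w \<otimes> inv w)"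
          using that tc by (simp only: inv_mult m_ac inv_closed m_closed)
        then show ?thesis using that tc by simp
      qed
      have "k = ?r + int d * ?q" by simp
      then have "b [^] k = b [^] ?r \<otimes> (b [^] int d) [^] ?q"
        by (metis b int_pow_mult int_pow_pow)
      then have yr: "?y = b [^] ?r \<otimes> (t \<otimes> inv (t0 [^] ?q))"
        unfolding k(3) using b tc by (simp only: int_pow_distrib int_pow_closed cancel)
      then have rD: "?r \<in> D" using y ts unfolding D_def by auto
      have "0 \<le> ?r" "?r < int d" using d(1) by simp_all
      then have "?r = 0"
        using least[of "nat ?r"] rD by (cases "0 < ?r") (simp_all add: le_nat_iff)
      then have "?y \<in> L \<inter> ?B" using y yr ts tc by simp
      then have "?y \<in> generate G (insert ?c U)"
        using mono_generate[of U "insert ?c U"] U(3) by auto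
      then have "?y \<otimes> ?c [^] ?q \<in> generate G (insert ?c U)"
        using cq(2) by (rule generate.eng)
      moreover have "?y \<otimes> ?c [^] ?q = x"
        using Lc x cq(1) by (simp add: m_assoc)
      ultimately show "x \<in> generate G (insert ?c U)" by simp
    qed
    moreover have "generate G (insert ?c U) \<subseteq> L"
      using generate_subgroup_incl[OF LU L] .
    moreover have "card (insert ?c U) \<le> card (insert b T)"
      using card_insert_le_m1 U insert.hyps by (simp add: card_insert_if)
    ultimately show ?thesis using U(1) LU by (intro exI[of _ "insert ?c U"]) auto
  qed
qed

text \<open>This is the source of the logarithm. Among the finite sets \<open>T\<close> whose
  generated subgroup meets at least \<open>2 ^ card T\<close> cosets of \<open>N\<close>, a largest
  one exists, because k < 2^k keeps its size below the index. Maximality then forces the generated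
  subgroup to meet every coset.\<close>

lemma generators_mod_subgroup:
  assumes N: "subgroup N G" and fin: "finite (rcosets N)"
  obtains T where "finite T" "T \<subseteq> carrier G" "2 ^ card T \<le> index G N"
    "\<And>a. a \<in> carrier G \<Longrightarrow> \<exists>t\<in>generate G T. a \<otimes> inv t \<in> N"
proof -
  define f where "f T = card ((\<lambda>a. N #> a) ` generate G T)" for T
  define Q where "Q T \<longleftrightarrow> finite T \<and> T \<subseteq> carrier G \<and> 2 ^ card T \<le> f T" for T
  have Nc: "N \<subseteq> carrier G" using N subgroup.subset by auto
  have sub: "(\<lambda>a. N #> a) ` generate G T \<subseteq> rcosets N" if "T \<subseteq> carrier G" for T
    using Nc generate_in_carrier[OF that] by (auto intro: rcosetsI)
  have f_le: "f T \<le> index G N" if "T \<subseteq> carrier G" for T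
    unfolding f_def index_def using card_mono[OF fin sub[OF that]] .
  have "Q {}" by (simp add: Q_def f_def generate_empty)
  have "\<forall>T. Q T \<longrightarrow> card T < index G N"
  proof (intro allI impI)
    fix T assume "Q T"
    then have "2 ^ card T \<le> f T" "T \<subseteq> carrier G" by (simp_all only: Q_def)
    then have "2 ^ card T \<le> index G N" using f_le order_trans by blast
    then show "card T < index G N" using less_exp[of "card T"] by linarith
  qed
  then have "\<exists>T. Q T \<and> (\<forall>T'. Q T' \<longrightarrow> card T' \<le> card T)"
    by (rule ex_has_greatest_nat[where P = Q, OF \<open>Q {}\<close>])
  then obtain T where T: "Q T" and "\<forall>T'. Q T' \<longrightarrow> card T' \<le> card T"
    by (elim exE conjE)
  then have max: "\<And>T'. Q T' \<Longrightarrow> card T' \<le> card T" by blast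
  have Tc: "T \<subseteq> carrier G" "finite T" using T Q_def by auto
  have gc: "\<And>t. t \<in> generate G T \<Longrightarrow> t \<in> carrier G" using generate_in_carrier[OF Tc(1)] .
  have "\<exists>t\<in>generate G T. a \<otimes> inv t \<in> N" if a: "a \<in> carrier G" for a
  proof (rule ccontr)
    assume no: "\<not> ?thesis"
    \<comment> \<open>Adding such an \<open>a\<close> would at least double \<open>f T\<close>, against the maximality of \<open>T\<close>.\<close>
    let ?T' = "insert a T"
    let ?I = "(\<lambda>t. N #> t) ` generate G T"
    let ?J = "(\<lambda>C. C #> a) ` ?I"
    have T'c: "?T' \<subseteq> carrier G" using a Tc by auto
    have "a \<notin> T"
    proof
      assume "a \<in> T"
      then have "a \<in> generate G T" by (rule generate.incl)
      then show False using no a subgroup.one_closed[OF N] by force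
    qed
    have inj: "inj_on (\<lambda>C. C #> a) ?I"
    proof (rule inj_onI)
      fix C D assume "C \<in> ?I" "D \<in> ?I" and eq: "C #> a = D #> a"
      then have CD: "C \<subseteq> carrier G" "D \<subseteq> carrier G"
        using gc r_coset_subset_G[OF Nc] by auto
      have "(C #> a) #> inv a = (D #> a) #> inv a" using eq by simp
      then show "C = D" using CD a by (simp add: coset_mult_assoc)
    qed
    \<comment> \<open>A common coset would make \<open>a\<close> congruent modulo \<open>N\<close>
      to the quotient of t by u, an element of \<open>generate G T\<close>, against the choice of
      \<open>a\<close>.\<close>
    have disj: "?I \<inter> ?J = {}"
    proof (rule ccontr)
      assume "?I \<inter> ?J \<noteq> {}"
      then obtain t u where tu: "t \<in> generate G T" "u \<in> generate G T" "N #> t = (N #> u) #> a"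
        by auto
      have c: "t \<in> carrier G" "u \<in> carrier G" using tu gc by auto
      have "N #> (u \<otimes> a) = N #> t" using tu c a Nc by (simp add: coset_mult_assoc)
      then have "(u \<otimes> a) \<otimes> inv t \<in> N" using c a by (simp add: r_coset_eq_iff[OF N])
      moreover have "(u \<otimes> a) \<otimes> inv t = a \<otimes> inv (t \<otimes> inv u)"
        using c a by (simp add: inv_mult m_ac)
      moreover have "t \<otimes> inv u \<in> generate G T"
        using tu generate_is_subgroup[OF Tc(1)] by (simp add: subgroup.m_closed subgroup.m_inv_closed)
      ultimately show False using no by auto
    qed
    have "?I \<union> ?J \<subseteq> (\<lambda>t. N #> t) ` generate G ?T'"
    proof -
      have "generate G T \<subseteq> generate G ?T'" by (rule mono_generate) auto
      moreover have "(N #> t) #> a \<in> (\<lambda>t. N #> t) ` generate G ?T'" if "t \<in> generate G T" for t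
      proof -
        have "t \<otimes> a \<in> generate G ?T'"
          using that \<open>generate G T \<subseteq> generate G ?T'\<close>
          by (intro generate.eng[OF _ generate.incl]) auto
        then show ?thesis using gc[OF that] a Nc by (simp add: coset_mult_assoc)
      qed
      ultimately show ?thesis by auto
    qed
    then have "card (?I \<union> ?J) \<le> f ?T'"
      unfolding f_def using finite_subset[OF sub[OF T'c] fin] by (intro card_mono)
    moreover have finI: "finite ?I" using finite_subset[OF sub[OF Tc(1)] fin] .
    then have "card (?I \<union> ?J) = f T + f T"
      using disj card_image[OF inj] by (simp add: card_Un_disjoint f_def)
    ultimately have "2 ^ card ?T' \<le> f ?T'"
      using T Tc \<open>a \<notin> T\<close> by (simp add: Q_def)
    then have "Q ?T'" using T'c Tc by (simp add: Q_def)
    then show False using max[of ?T'] Tc \<open>a \<notin> T\<close> by simp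
  qed
  moreover have "2 ^ card T \<le> index G N" using T f_le[OF Tc(1)] by (simp add: Q_def)
  ultimately show ?thesis using that Tc by blast
qed

end

section \<open>Generating a subgroup with the help of an abelian normal subgroup\<close>

context group begin

text \<open>Every element of \<open>Y\<close> is an element of \<open>generate G T\<close> times an
  H-part. The H-parts alone may generate too little, because conjugation by them need not preserve
  \<open>generate G T\<close>. The errors of these conjugations lie in \<open>H \<inter> A\<close>;
  once they are added, every element of \<open>H\<close> is an element of
  \<open>generate G T\<close> times a generated one, and \<open>U\<close> supplies the first
  factor.\<close>

lemma supplemented_subgroup_generators:
  assumes A: "A \<lhd> G" and comm: "\<And>x y. x \<in> A \<Longrightarrow> y \<in> A \<Longrightarrow> x \<otimes> y = y \<otimes> x"
    and H: "subgroup H G"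
    and T: "finite T" "T \<subseteq> A" "\<And>a. a \<in> A \<Longrightarrow> \<exists>t\<in>generate G T. a \<otimes> inv t \<in> H"
    and Y: "finite Y" "\<And>y. y \<in> Y \<Longrightarrow> \<exists>a\<in>A. \<exists>h\<in>H. y = a \<otimes> h" "H \<subseteq> generate G Y"
    and U: "finite U" "U \<subseteq> H" "generate G U = H \<inter> generate G T"
  obtains S where "finite S" "S \<subseteq> H" "generate G S = H"
    "card S \<le> card Y + 2 * card Y * card T + card U"
proof -
  interpret A: normal A G by fact
  interpret H: subgroup H G by fact
  let ?B = "generate G T"
  have B: "subgroup ?B G" using T(2) A.subset by (intro generate_is_subgroup) auto
  interpret B: subgroup ?B G by fact
  have BA: "?B \<subseteq> A" using T(2) A.subgroup_axioms by (rule generate_subgroup_incl)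
  have split: "\<exists>b\<in>?B. \<exists>n\<in>H \<inter> A. a = b \<otimes> n" if a: "a \<in> A" for a
  proof -
    obtain b where b: "b \<in> ?B" "a \<otimes> inv b \<in> H" using T(3)[OF a] by blast
    then have bA: "b \<in> A" using BA by blast
    then have n: "a \<otimes> inv b \<in> A" using a by simp
    have "b \<otimes> (a \<otimes> inv b) = (a \<otimes> inv b) \<otimes> b" using bA n by (rule comm)
    also have "\<dots> = a" using a bA by (simp add: m_assoc)
    finally show ?thesis using b n by (metis IntI)
  qed
  have "\<exists>h\<in>H. \<exists>b\<in>?B. y = b \<otimes> h" if y: "y \<in> Y" for y
  proof -
    obtain a h where ah: "a \<in> A" "h \<in> H" "y = a \<otimes> h" using Y(2)[OF y] by blast
    obtain b n where bn: "b \<in> ?B" "n \<in> H" "a = b \<otimes> n" using split[OF ah(1)] by blast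
    then have "y = b \<otimes> (n \<otimes> h)" using ah by (simp add: m_assoc)
    then show ?thesis using bn ah by blast
  qed
  then obtain \<eta> where \<eta>: "\<And>y. y \<in> Y \<Longrightarrow> \<eta> y \<in> H" "\<And>y. y \<in> Y \<Longrightarrow> \<exists>b\<in>?B. y = b \<otimes> \<eta> y"
    by metis
  \<comment> \<open>Inverses are included because left multiplication by \<open>inv y\<close> passes
    through \<open>inv \<eta> y\<close>. This is the origin of the 2 in the bound on
    \<open>card S\<close>.\<close>
  define W where "W = \<eta> ` Y \<union> (\<lambda>y. inv \<eta> y) ` Y"
  have WH: "W \<subseteq> H" using \<eta> by (auto simp: W_def)
  have "\<exists>n\<in>H \<inter> A. \<exists>b\<in>?B. w \<otimes> t \<otimes> inv w = b \<otimes> n" if wt: "w \<in> W" "t \<in> T" for w t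
  proof -
    have "w \<otimes> t \<otimes> inv w \<in> A"
      using wt WH T(2) by (intro A.inv_op_closed2) auto
    then show ?thesis using split by blast
  qed
  then obtain \<nu> where \<nu>: "\<And>w t. w \<in> W \<Longrightarrow> t \<in> T \<Longrightarrow> \<nu> w t \<in> H \<inter> A"
    "\<And>w t. w \<in> W \<Longrightarrow> t \<in> T \<Longrightarrow> \<exists>b\<in>?B. w \<otimes> t \<otimes> inv w = b \<otimes> \<nu> w t"
    by metis
  define S where "S = \<eta> ` Y \<union> (\<lambda>(w, t). \<nu> w t) ` (W \<times> T) \<union> U"
  let ?L = "generate G S"
  have SH: "S \<subseteq> H" using \<eta>(1) \<nu>(1) U(2) by (auto simp: S_def)
  then have LH: "?L \<subseteq> H" using H by (rule generate_subgroup_incl)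
  have L: "subgroup ?L G" using SH by (intro generate_is_subgroup) auto
  interpret L: subgroup ?L G by fact
  have WL: "W \<subseteq> ?L" unfolding W_def S_def by (auto intro: generate.incl generate.inv)
  \<comment> \<open>Commutativity of \<open>A\<close> makes \<open>M\<close> closed under products
    and inverses. It therefore suffices to have the conjugates of the elements of \<open>T\<close>
    in \<open>M\<close>, and the elements \<open>\<nu> w t\<close> of \<open>S\<close> achieve
    this.\<close>
  define M where "M = {b \<otimes> n | b n. b \<in> ?B \<and> n \<in> ?L \<inter> A}"
  have M_mult: "x \<otimes> y \<in> M" if xy: "x \<in> M" "y \<in> M" for x y
  proof -
    obtain b n c k where bn: "b \<in> ?B" "n \<in> ?L \<inter> A" "x = b \<otimes> n"
      and ck: "c \<in> ?B" "k \<in> ?L \<inter> A" "y = c \<otimes> k" using xy M_def by auto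
    have "x \<otimes> y = b \<otimes> (n \<otimes> c) \<otimes> k" using bn ck by (simp add: m_assoc)
    also have "n \<otimes> c = c \<otimes> n" using bn ck BA by (intro comm) auto
    also have "b \<otimes> (c \<otimes> n) \<otimes> k = (b \<otimes> c) \<otimes> (n \<otimes> k)" using bn ck by (simp add: m_assoc)
    finally show ?thesis using bn ck unfolding M_def by blast
  qed
  have M_inv: "inv x \<in> M" if x: "x \<in> M" for x
  proof -
    obtain b n where bn: "b \<in> ?B" "n \<in> ?L \<inter> A" "x = b \<otimes> n" using x M_def by auto
    have "inv x = inv n \<otimes> inv b" using bn by (simp add: inv_mult_group)
    also have "\<dots> = inv b \<otimes> inv n" using bn BA by (intro comm) auto
    finally show ?thesis using bn unfolding M_def by blast
  qed
  have cancel: "inv w \<otimes> (w \<otimes> z) = z" if "w \<in> carrier G" "z \<in> carrier G" for w z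
    using that by (simp add: m_assoc[symmetric])
  have conj: "w \<otimes> b \<otimes> inv w \<in> M" if w: "w \<in> W" and b: "b \<in> ?B" for w b
  proof -
    have wc: "w \<in> carrier G" using w WH by auto
    have gen: "w \<otimes> t \<otimes> inv w \<in> M" if "t \<in> T" for t
    proof -
      have "\<nu> w t \<in> S" using w that unfolding S_def by force
      then have "\<nu> w t \<in> ?L \<inter> A" using \<nu>(1)[OF w that] by (auto intro: generate.incl)
      then show ?thesis using \<nu>(2)[OF w that] unfolding M_def by blast
    qed
    from b show ?thesis
    proof induction
      case one
      have "\<one> \<otimes> \<one> \<in> M" unfolding M_def using generate.one[of G] A.one_closed by blast
      then show ?case using wc by simp
    next
      case (incl t)
      then show ?case by (rule gen)
    next
      case (inv t)
      then have "t \<in> carrier G" using T(2) by auto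
      then have "w \<otimes> inv t \<otimes> inv w = inv (w \<otimes> t \<otimes> inv w)"
        using wc by (simp add: inv_mult_group m_assoc)
      then show ?case using M_inv[OF gen[OF inv]] by simp
    next
      case (eng s t)
      then have "(w \<otimes> s \<otimes> inv w) \<otimes> (w \<otimes> t \<otimes> inv w) \<in> M" using M_mult by blast
      moreover have "(w \<otimes> s \<otimes> inv w) \<otimes> (w \<otimes> t \<otimes> inv w) = w \<otimes> (s \<otimes> t) \<otimes> inv w"
        using wc B.mem_carrier[OF eng(1)] B.mem_carrier[OF eng(2)] by (simp add: m_assoc cancel)
      ultimately show ?case by simp
    qed
  qed
  \<comment> \<open>\<open>P\<close> is stable under left multiplication by \<open>Y\<close> and its inverses, so it contains \<open>H\<close>.\<close>
  define P where "P = {b \<otimes> h | b h. b \<in> ?B \<and> h \<in> ?L}"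
  have Pc: "P \<subseteq> carrier G" unfolding P_def by auto
  have B_P: "b \<otimes> p \<in> P" if b: "b \<in> ?B" and p: "p \<in> P" for b p
  proof -
    obtain c h where "c \<in> ?B" "h \<in> ?L" "p = c \<otimes> h" using p P_def by auto
    then have "b \<otimes> p = (b \<otimes> c) \<otimes> h" "b \<otimes> c \<in> ?B" using b by (simp_all add: m_assoc)
    then show ?thesis using \<open>h \<in> ?L\<close> unfolding P_def by blast
  qed
  have W_P: "w \<otimes> p \<in> P" if w: "w \<in> W" and p: "p \<in> P" for w p
  proof -
    obtain b h where bh: "b \<in> ?B" "h \<in> ?L" "p = b \<otimes> h" using p P_def by auto
    obtain c n where cn: "c \<in> ?B" "n \<in> ?L" "w \<otimes> b \<otimes> inv w = c \<otimes> n"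
      using conj[OF w bh(1)] M_def by auto
    have wL: "w \<in> ?L" using w WL by auto
    \<comment> \<open>Passing w across b replaces b by its conjugate, which is an element of
      \<open>?B\<close> times one of \<open>?L\<close>; the latter joins the right factor.\<close>
    have "w \<otimes> p = (w \<otimes> b \<otimes> inv w) \<otimes> (w \<otimes> h)"
      using wL bh by (simp add: m_assoc cancel)
    also have "\<dots> = c \<otimes> (n \<otimes> (w \<otimes> h))" using cn bh wL by (simp add: m_assoc)
    finally show ?thesis using cn bh wL unfolding P_def by blast
  qed
  have Y_P: "y \<otimes> p \<in> P" "inv y \<otimes> p \<in> P" if y: "y \<in> Y" and p: "p \<in> P" for y p
  proof -
    obtain b where b: "b \<in> ?B" "y = b \<otimes> \<eta> y" using \<eta>(2)[OF y] by blast
    have c: "\<eta> y \<in> carrier G" "p \<in> carrier G" "b \<in> carrier G" using \<eta>(1)[OF y] p Pc b by auto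
    have w: "\<eta> y \<in> W" "inv \<eta> y \<in> W" using y by (auto simp: W_def)
    have "y \<otimes> p = b \<otimes> (\<eta> y \<otimes> p)" using c by (subst b(2)) (simp add: m_assoc)
    then show "y \<otimes> p \<in> P" using B_P[OF b(1) W_P[OF w(1) p]] by simp
    have "inv y \<otimes> p = inv \<eta> y \<otimes> (inv b \<otimes> p)"
      using c by (subst b(2)) (simp add: m_assoc inv_mult_group)
    then show "inv y \<otimes> p \<in> P" using W_P[OF w(2) B_P[OF _ p]] b(1) by simp
  qed
  have Yc: "Y \<subseteq> carrier G" using Y(2) by fastforce
  have gP: "\<forall>p\<in>P. g \<otimes> p \<in> P" if "g \<in> generate G Y" for g
    using that
  proof induction
    case one
    then show ?case using Pc by auto
  next
    case (incl h)
    then show ?case using Y_P by blast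
  next
    case (inv h)
    then show ?case using Y_P by blast
  next
    case (eng g h)
    then have c: "g \<in> carrier G" "h \<in> carrier G" using generate_in_carrier[OF Yc] by auto
    show ?case
    proof
      fix p assume p: "p \<in> P"
      then have "g \<otimes> (h \<otimes> p) \<in> P" using eng.IH by blast
      then show "g \<otimes> h \<otimes> p \<in> P" using c p Pc by (simp add: m_assoc subsetD)
    qed
  qed
  have "\<one> \<otimes> \<one> \<in> P" unfolding P_def using generate.one[of G] by blast
  then have oneP: "\<one> \<in> P" by simp
  \<comment> \<open>In a decomposition h = b l both h and l lie in \<open>H\<close>, so b lies in
    \<open>H \<inter> ?B\<close>, which \<open>U\<close> generates inside \<open>?L\<close>.\<close>
  have "H \<subseteq> ?L"
  proof
    fix h assume h: "h \<in> H"
    then have "h \<otimes> \<one> \<in> P" using gP oneP Y(3) by blast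
    then obtain b l where bl: "b \<in> ?B" "l \<in> ?L" "h = b \<otimes> l" using h P_def by auto
    then have b: "b = h \<otimes> inv l" by (simp add: m_assoc)
    have "l \<in> H" using bl LH by auto
    then have "b \<in> H" using b h by simp
    then have "b \<in> generate G U" using bl U(3) by auto
    then have "b \<in> ?L" using mono_generate[of U S] by (auto simp: S_def)
    then show "h \<in> ?L" using bl by simp
  qed
  moreover have "finite W" using Y(1) by (simp add: W_def)
  then have "finite S" using Y(1) T(1) U(1) by (simp add: S_def)
  moreover have "card S \<le> card Y + 2 * card Y * card T + card U"
  proof -
    have "card W \<le> card Y + card Y"
      unfolding W_def using card_image_le[OF Y(1)] by (meson add_mono card_Un_le order_trans)
    moreover have "card ((\<lambda>(w, t). \<nu> w t) ` (W \<times> T)) \<le> card W * card T"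
      using card_image_le[of "W \<times> T"] \<open>finite W\<close> T(1) by (simp add: card_cartesian_product)
    ultimately have "card ((\<lambda>(w, t). \<nu> w t) ` (W \<times> T)) \<le> 2 * card Y * card T"
      by (metis mult_2 mult_le_mono1 order_trans)
    moreover have "card S \<le> card (\<eta> ` Y) + card ((\<lambda>(w, t). \<nu> w t) ` (W \<times> T)) + card U"
      unfolding S_def by (meson add_mono card_Un_le order_refl order_trans)
    ultimately show ?thesis using card_image_le[OF Y(1), of \<eta>] by linarith
  qed
  ultimately show ?thesis using that SH LH by blast
qed

text \<open>\<open>M\<close> is the kernel of the action on the cosets of \<open>H\<close> by right
  multiplication. Instead of the finite index of \<open>M\<close>, the consequence wanted later is
  recorded. It follows from the pigeonhole principle: infinitely many elements of \<open>B\<close>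
  act alike, and their quotients lie in \<open>M\<close>.\<close>

lemma ex_normal_core:
  assumes H: "subgroup H G" and fin: "finite (rcosets H)"
  obtains M where "M \<lhd> G" "M \<subseteq> H"
    "\<And>B. subgroup B G \<Longrightarrow> infinite B \<Longrightarrow> infinite (B \<inter> M)"
proof -
  define M where "M = {x \<in> carrier G. \<forall>g\<in>carrier G. g \<otimes> x \<otimes> inv g \<in> H}"
  interpret H: subgroup H G by fact
  have MH: "M \<subseteq> H"
  proof
    fix x assume x: "x \<in> M"
    then have "\<one> \<otimes> x \<otimes> inv \<one> \<in> H" unfolding M_def by blast
    then show "x \<in> H" using x by (simp add: M_def)
  qed
  have conj_conj: "g \<otimes> (h \<otimes> x \<otimes> inv h) \<otimes> inv g = (g \<otimes> h) \<otimes> x \<otimes> inv (g \<otimes> h)"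
    if "g \<in> carrier G" "h \<in> carrier G" "x \<in> carrier G" for g h x
    using that by (simp add: m_assoc inv_mult_group)
  have conj_mult: "g \<otimes> (x \<otimes> y) \<otimes> inv g = (g \<otimes> x \<otimes> inv g) \<otimes> (g \<otimes> y \<otimes> inv g)"
    if "g \<in> carrier G" "x \<in> carrier G" "y \<in> carrier G" for g x y
    using that by (simp add: m_assoc) (simp add: m_assoc[symmetric])
  have conj_inv: "g \<otimes> inv x \<otimes> inv g = inv (g \<otimes> x \<otimes> inv g)"
    if "g \<in> carrier G" "x \<in> carrier G" for g x
    using that by (simp add: m_assoc inv_mult_group)
  have "subgroup M G"
    by (rule subgroupI) (auto simp: M_def conj_mult conj_inv intro!: exI[of _ \<one>])
  moreover have "x \<otimes> h \<otimes> inv x \<in> M" if "x \<in> carrier G" "h \<in> M" for x h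
    using that by (simp add: M_def conj_conj)
  ultimately have "M \<lhd> G" by (simp add: normal_inv_iff)
  moreover have "infinite (B \<inter> M)" if B: "subgroup B G" "infinite B" for B
  proof -
    \<comment> \<open>The action of x, restricted to the finite set of cosets so that only finitely
      many values of \<open>f\<close> are possible.\<close>
    define f where "f x = (\<lambda>C\<in>rcosets H. C #> x)" for x
    have Bc: "B \<subseteq> carrier G" using B subgroup.subset by auto
    have "C #> x \<in> rcosets H" if C: "C \<in> rcosets H" and x: "x \<in> B" for C x
    proof -
      obtain g where g: "g \<in> carrier G" "C = H #> g" using C by (auto simp: RCOSETS_def)
      have "x \<in> carrier G" using x Bc by auto
      then show ?thesis using g H.subset by (simp add: coset_mult_assoc rcosetsI)
    qed
    then have "f ` B \<subseteq> PiE (rcosets H) (\<lambda>_. rcosets H)"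
      by (auto simp: f_def)
    then have "finite (f ` B)" using finite_PiE[OF fin fin] finite_subset by blast
    then obtain y where y: "y \<in> B" "infinite {x \<in> B. f x = f y}"
      using pigeonhole_infinite[OF B(2)] by blast
    have "(\<lambda>x. x \<otimes> inv y) ` {x \<in> B. f x = f y} \<subseteq> B \<inter> M"
    proof clarify
      fix x assume x: "x \<in> B" "f x = f y"
      then have c: "x \<in> carrier G" "y \<in> carrier G" using y Bc by auto
      have "g \<otimes> (x \<otimes> inv y) \<otimes> inv g \<in> H" if g: "g \<in> carrier G" for g
      proof -
        have "(H #> g) #> x = (H #> g) #> y"
          using x(2) rcosetsI[OF H.subset g] by (metis f_def restrict_apply')
        then have "H #> (g \<otimes> x) = H #> (g \<otimes> y)"
          using g c H.subset by (simp add: coset_mult_assoc)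
        then have "(g \<otimes> x) \<otimes> inv (g \<otimes> y) \<in> H"
          using g c by (simp add: r_coset_eq_iff[OF H])
        then show ?thesis using g c by (simp add: m_assoc inv_mult_group)
      qed
      then show "x \<otimes> inv y \<in> B \<inter> M"
        using x y B c by (simp add: M_def subgroup.m_closed subgroup.m_inv_closed)
    qed
    moreover have "inj_on (\<lambda>x. x \<otimes> inv y) {x \<in> B. f x = f y}"
    proof (rule inj_onI)
      fix x z assume "x \<in> {x \<in> B. f x = f y}" "z \<in> {x \<in> B. f x = f y}" "x \<otimes> inv y = z \<otimes> inv y"
      then show "x = z" using Bc y(1) by (simp add: subsetD)
    qed
    ultimately show ?thesis using y(2) finite_imageD finite_subset by blast
  qed
  ultimately show ?thesis using that MH by blast
qed

text \<open>Here q is the index of AH, and l is the size of a set generating \<open>A\<close> modulo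
  \<open>A \<inter> H\<close>. Schreier's bound is applied to AH and not to \<open>H\<close>, so it
  grows with q only, and the descent from AH to \<open>H\<close> costs a factor linear in l.\<close>

lemma rank_bound_of_abelian_normal:
  assumes Y: "finite Y" "Y \<subseteq> carrier G" "generate G Y = carrier G"
    and A: "A \<lhd> G" and comm: "\<And>x y. x \<in> A \<Longrightarrow> y \<in> A \<Longrightarrow> x \<otimes> y = y \<otimes> x"
    and H: "subgroup H G" and fin: "finite (rcosets H)"
  obtains q l where "index G H = q * card ((\<lambda>a. H #> a) ` A)" "2 ^ l \<le> card ((\<lambda>a. H #> a) ` A)"
    "min_gens G H \<le> 2 * card Y * q * (1 + 2 * l) + l"
proof -
  interpret A: normal A G by fact
  interpret H: subgroup H G by fact
  let ?K = "A <#> H" and ?A = "G\<lparr>carrier := A\<rparr>" and ?N = "H \<inter> A"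
  let ?m = "card ((\<lambda>a. H #> a) ` A)"
  have K: "subgroup ?K G" using A H by (rule mult_norm_subgroup)
  have K_mem: "a \<otimes> h \<in> ?K" if "a \<in> A" "h \<in> H" for a h
    unfolding set_mult_def using that by blast
  have HK: "H \<subseteq> ?K" using K_mem[OF A.one_closed] by fastforce
  \<comment> \<open>Writing a h as h times a conjugate of a shows that AH meets the same cosets of
    \<open>H\<close> as \<open>A\<close> does.\<close>
  have "(\<lambda>x. H #> x) ` ?K = (\<lambda>a. H #> a) ` A"
  proof (intro equalityI subsetI)
    fix C assume "C \<in> (\<lambda>x. H #> x) ` ?K"
    then obtain a h where ah: "a \<in> A" "h \<in> H" "C = H #> (a \<otimes> h)"
      by (auto simp: set_mult_def)
    have "a \<otimes> h = h \<otimes> (inv h \<otimes> a \<otimes> h)" using ah by (simp add: m_assoc[symmetric])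
    then have "C = (H #> h) #> (inv h \<otimes> a \<otimes> h)"
      using ah H.subset by (simp add: coset_mult_assoc)
    also have "H #> h = H" using ah by (intro coset_join2 H) auto
    finally show "C \<in> (\<lambda>a. H #> a) ` A"
      using A.inv_op_closed1[of h a] ah by auto
  next
    fix C assume "C \<in> (\<lambda>a. H #> a) ` A"
    moreover have "A \<subseteq> ?K" using K_mem[OF _ H.one_closed] by fastforce
    ultimately show "C \<in> (\<lambda>x. H #> x) ` ?K" by blast
  qed
  then have idx: "index G H = index G ?K * ?m"
    using index_mult[OF H K HK] by simp
  \<comment> \<open>A product of cardinalities that is positive has positive factors, and a set of
    positive \<open>card\<close> is finite.\<close>
  have "rcosets H \<noteq> {}" by (auto simp: RCOSETS_def)
  then have "index G H > 0" using fin by (simp add: index_def card_gt_0_iff)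
  then have finK: "finite (rcosets ?K)" and finm: "finite ((\<lambda>a. H #> a) ` A)"
    using idx by (auto simp: index_def card_gt_0_iff)
  \<comment> \<open>Viewing \<open>A\<close> as a group of its own gives access to the results on
    abelian groups; \<open>gen\<close> below carries generated subgroups back.\<close>
  interpret Ag: comm_group ?A
    by (rule group.group_comm_groupI) (auto simp: comm subgroup_imp_group A.subgroup_axioms)
  have N: "subgroup ?N G" using H A.subgroup_axioms by (rule subgroups_Inter_pair)
  have NA: "subgroup ?N ?A" by (rule subgroup_incl[OF N A.subgroup_axioms]) simp
  \<comment> \<open>Intersection with \<open>A\<close> sends the coset of \<open>H\<close> through a
    to the coset of \<open>?N\<close> through a. Its injectivity, shown next, identifies
    \<open>?m\<close> with the index of \<open>?N\<close> in \<open>A\<close>.\<close>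
  have cosN: "rcosets\<^bsub>?A\<^esub> ?N = (\<lambda>C. C \<inter> A) ` (\<lambda>a. H #> a) ` A"
  proof -
    have "(H #> a) \<inter> A = ?N #> a" if a: "a \<in> A" for a
    proof (intro equalityI subsetI)
      fix x assume x: "x \<in> (H #> a) \<inter> A"
      then obtain h where h: "h \<in> H" "x = h \<otimes> a" by (auto simp: r_coset_def)
      then have "h = x \<otimes> inv a" using a by (simp add: m_assoc)
      then have "h \<in> A" using x a by simp
      then show "x \<in> ?N #> a" using h by (auto simp: r_coset_def)
    next
      fix x assume "x \<in> ?N #> a"
      then show "x \<in> (H #> a) \<inter> A" using a by (auto simp: r_coset_def)
    qed
    then show ?thesis by (auto simp: RCOSETS_def image_iff)
  qed
  have "inj_on (\<lambda>C. C \<inter> A) ((\<lambda>a. H #> a) ` A)"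
  proof (rule inj_onI)
    fix C D assume CD: "C \<in> (\<lambda>a. H #> a) ` A" "D \<in> (\<lambda>a. H #> a) ` A" "C \<inter> A = D \<inter> A"
    then obtain a b where ab: "a \<in> A" "b \<in> A" "C = H #> a" "D = H #> b" by auto
    then have "a \<in> D" using CD(3) rcos_self[OF _ H, of a] by auto
    then show "C = D" using ab repr_independence[OF _ _ H, of a b] by simp
  qed
  then have idxN: "index ?A ?N = ?m" unfolding index_def cosN by (rule card_image)
  obtain T where T: "finite T" "T \<subseteq> A" "2 ^ card T \<le> ?m"
    "\<And>a. a \<in> A \<Longrightarrow> \<exists>t\<in>generate ?A T. a \<otimes> inv\<^bsub>?A\<^esub> t \<in> ?N"
    using Ag.generators_mod_subgroup[OF NA] cosN finm idxN by auto
  have gen: "generate ?A S = generate G S" if "S \<subseteq> A" for S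
    using that A.subgroup_axioms by (rule generate_consistent)
  have TA: "generate G T \<subseteq> A" using T(2) A.subgroup_axioms by (rule generate_subgroup_incl)
  have cover: "\<exists>t\<in>generate G T. a \<otimes> inv t \<in> H" if "a \<in> A" for a
    using T(4)[OF that] TA gen[OF T(2)] m_inv_consistent[OF A.subgroup_axioms] by force
  have "subgroup (generate G T) G" using T(2) A.subset by (intro generate_is_subgroup) auto
  then have "subgroup (H \<inter> generate G T) G" by (rule subgroups_Inter_pair[OF H])
  then have "subgroup (H \<inter> generate G T) ?A"
    using TA by (intro subgroup_incl A.subgroup_axioms) auto
  then obtain U where U: "finite U" "U \<subseteq> H \<inter> generate G T" "generate ?A U = H \<inter> generate G T"
    "card U \<le> card T"
    using Ag.subgroup_generators_le[of T "H \<inter> generate G T"] T(1,2) gen[OF T(2)] by auto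
  have UA: "generate G U = H \<inter> generate G T" using U(2,3) TA gen[of U] by blast
  obtain Z where Z: "finite Z" "Z \<subseteq> ?K" "generate G Z = ?K" "card Z \<le> 2 * card Y * index G ?K"
    using schreier_generators[OF K finK Y] .
  obtain S where S: "finite S" "S \<subseteq> H" "generate G S = H"
    "card S \<le> card Z + 2 * card Z * card T + card U"
  proof (rule supplemented_subgroup_generators[OF A comm H T(1,2) cover Z(1) _ _ U(1) _ UA])
    show "\<exists>a\<in>A. \<exists>h\<in>H. z = a \<otimes> h" if "z \<in> Z" for z
      using subsetD[OF Z(2) that] by (auto simp: set_mult_def)
    show "H \<subseteq> generate G Z" using HK Z(3) by simp
    show "U \<subseteq> H" using U(2) by auto
  qed
  have "min_gens G H \<le> card S"
    unfolding min_gens_def using S by (intro Least_le) blast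
  also have "\<dots> \<le> card Z * (1 + 2 * card T) + card T"
    using S(4) U(4) by (simp add: algebra_simps)
  also have "\<dots> \<le> 2 * card Y * index G ?K * (1 + 2 * card T) + card T"
    using Z(4) by (intro add_mono mult_le_mono1) auto
  finally show ?thesis using that[OF idx T(3)] by simp
qed

end

section \<open>Decreasing sequences of subgroups with trivial intersection\<close>

lemma decreasing_separates_finite:
  fixes \<Gamma> :: "nat \<Rightarrow> 'a set"
  assumes "decseq \<Gamma>" "finite F"
  shows "eventually (\<lambda>n. F \<inter> \<Gamma> n \<subseteq> (\<Inter>n. \<Gamma> n)) sequentially"
proof -
  have "eventually (\<lambda>n. x \<in> \<Gamma> n \<longrightarrow> x \<in> (\<Inter>n. \<Gamma> n)) sequentially" for x
  proof (cases "x \<in> (\<Inter>n. \<Gamma> n)")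
    case False
    then obtain k where "x \<notin> \<Gamma> k" by auto
    then have "x \<notin> \<Gamma> n" if "n \<ge> k" for n using decseqD[OF assms(1) that] by blast
    then show ?thesis unfolding eventually_sequentially by blast
  qed simp
  then have "eventually (\<lambda>n. \<forall>x\<in>F. x \<in> \<Gamma> n \<longrightarrow> x \<in> (\<Inter>n. \<Gamma> n)) sequentially"
    using assms(2) by (simp add: eventually_ball_finite)
  then show ?thesis by (rule eventually_mono) blast
qed

context group begin

text \<open>Commutators from the last infinite derived term lie in the next term, which is finite.
  Some \<open>\<Gamma> n\<close> meets this finite term trivially, so the commutators vanish inside
  the normal core of \<open>\<Gamma> n\<close>, and the intersection with that core is still
  infinite.\<close>

lemma ex_infinite_abelian_normal:
  assumes N: "N \<lhd> G" "infinite N" "solvable (G\<lparr>carrier := N\<rparr>)"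
    and \<Gamma>: "decseq \<Gamma>" "\<And>n. subgroup (\<Gamma> n) G" "\<And>n. finite (rcosets (\<Gamma> n))" "(\<Inter>n. \<Gamma> n) = {\<one>}"
  obtains A where "A \<lhd> G" "infinite A" "\<forall>x\<in>A. \<forall>y\<in>A. x \<otimes> y = y \<otimes> x"
proof -
  have Ns: "subgroup N G" using N(1) by (rule normal_imp_subgroup)
  \<comment> \<open>The derived series of \<open>N\<close> is computed in \<open>G\<close>, which
    makes every term normal in \<open>G\<close>. It is identified below with the series computed in
    \<open>N\<close>, to which solvability refers.\<close>
  define D where "D i = (derived G ^^ i) N" for i
  have D_Suc: "D (Suc i) = derived G (D i)" for i by (simp add: D_def)
  have Dn: "D i \<lhd> G" for i
    by (induction i) (use N(1) in \<open>simp_all add: D_def derived_is_normal\<close>)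
  have DN: "D i \<subseteq> N" for i
  proof (induction i)
    case (Suc i)
    then show ?case unfolding D_Suc using Ns by (rule derived_incl)
  qed (simp add: D_def)
  have "(derived (G\<lparr>carrier := N\<rparr>) ^^ i) N = D i" for i
  proof (induction i)
    case (Suc i)
    then show ?case using derived_consistent[OF DN Ns] by (simp add: D_Suc)
  qed (simp add: D_def)
  then obtain k where "D k = {\<one>}"
    using group.solvable_iff_trivial_derived_seq[OF subgroup_imp_group[OF Ns]] N(3) by auto
  then have ex: "\<exists>k. finite (D k)" by (metis finite.emptyI finite.insertI)
  \<comment> \<open>As \<open>D 0\<close> is the infinite group \<open>N\<close>, the least index j
    is positive, and its predecessor gives an infinite term with finite derived subgroup.\<close>
  define j where "j = (LEAST k. finite (D k))"
  have "finite (D j)" unfolding j_def using ex by (rule LeastI_ex)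
  moreover have "infinite (D 0)" using N(2) by (simp add: D_def)
  ultimately obtain i where i: "j = Suc i" by (cases j) auto
  have finF: "finite (D (Suc i))" using \<open>finite (D j)\<close> i by simp
  have infB: "infinite (D i)" using not_less_Least[of i "\<lambda>k. finite (D k)"] i j_def by simp
  obtain n where n: "D (Suc i) \<inter> \<Gamma> n \<subseteq> {\<one>}"
    using eventually_happens[OF decreasing_separates_finite[OF \<Gamma>(1) finF]] \<Gamma>(4) by auto
  obtain M where M: "M \<lhd> G" "M \<subseteq> \<Gamma> n"
    "\<And>B. subgroup B G \<Longrightarrow> infinite B \<Longrightarrow> infinite (B \<inter> M)"
    using ex_normal_core[OF \<Gamma>(2,3)] by blast
  interpret B: normal "D i" G by (rule Dn)
  interpret M: normal M G by (rule M(1))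
  have "x \<otimes> y = y \<otimes> x" if x: "x \<in> D i \<inter> M" and y: "y \<in> D i \<inter> M" for x y
  proof -
    have c: "x \<in> carrier G" "y \<in> carrier G" using x y by auto
    have "x \<otimes> y \<otimes> inv x \<otimes> inv y \<in> D (Suc i)"
      unfolding D_Suc derived_def using x y by (auto intro!: generate.incl)
    moreover have "x \<otimes> y \<otimes> inv x \<otimes> inv y \<in> M" using x y by simp
    ultimately have *: "x \<otimes> y \<otimes> inv x \<otimes> inv y = \<one>" using n M(2) by blast
    have "x \<otimes> y = (x \<otimes> y \<otimes> inv x \<otimes> inv y) \<otimes> (y \<otimes> x)"
      using c by (simp add: m_assoc) (simp add: m_assoc[symmetric])
    then show ?thesis using * c by simp
  qed
  moreover have "D i \<inter> M \<lhd> G" using Dn M(1) by (rule normal_subgroup_intersect)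
  moreover have "infinite (D i \<inter> M)" using M(3) infB B.subgroup_axioms by blast
  ultimately show ?thesis using that by blast
qed

text \<open>Any k elements of \<open>A\<close> have finitely many quotients, and for large n only
  the trivial one lies in \<open>\<Gamma> n\<close>. The k elements then represent distinct
  cosets.\<close>

lemma card_cosets_at_top:
  assumes A: "subgroup A G" "infinite A"
    and \<Gamma>: "decseq \<Gamma>" "\<And>n. subgroup (\<Gamma> n) G" "\<And>n. finite (rcosets (\<Gamma> n))" "(\<Inter>n. \<Gamma> n) = {\<one>}"
  shows "filterlim (\<lambda>n. card ((\<lambda>a. \<Gamma> n #> a) ` A)) at_top sequentially"
  unfolding filterlim_at_top
proof
  fix k :: nat
  obtain C where C: "finite C" "card C = k" "C \<subseteq> A"
    using infinite_arbitrarily_large[OF A(2)] by blast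
  have Ac: "A \<subseteq> carrier G" using A subgroup.subset by auto
  have "finite ((\<lambda>(x, y). x \<otimes> inv y) ` (C \<times> C))" using C by simp
  then have "eventually (\<lambda>n. (\<lambda>(x, y). x \<otimes> inv y) ` (C \<times> C) \<inter> \<Gamma> n \<subseteq> {\<one>}) sequentially"
    using decreasing_separates_finite[OF \<Gamma>(1)] unfolding \<Gamma>(4) by blast
  then show "eventually (\<lambda>n. k \<le> card ((\<lambda>a. \<Gamma> n #> a) ` A)) sequentially"
  proof (rule eventually_mono)
    fix n assume n: "(\<lambda>(x, y). x \<otimes> inv y) ` (C \<times> C) \<inter> \<Gamma> n \<subseteq> {\<one>}"
    have "inj_on (\<lambda>a. \<Gamma> n #> a) C"
    proof (rule inj_onI)
      fix x y assume xy: "x \<in> C" "y \<in> C" "\<Gamma> n #> x = \<Gamma> n #> y"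
      then have c: "x \<in> carrier G" "y \<in> carrier G" using C Ac by auto
      then have "x \<otimes> inv y \<in> \<Gamma> n" using xy r_coset_eq_iff[OF \<Gamma>(2)] by blast
      then have "x \<otimes> inv y = \<one>" using n xy by force
      then show "x = y" using c by (metis inv_equality inv_inv inv_closed)
    qed
    then have "k = card ((\<lambda>a. \<Gamma> n #> a) ` C)" using C by (simp add: card_image)
    also have "\<dots> \<le> card ((\<lambda>a. \<Gamma> n #> a) ` A)"
    proof (rule card_mono)
      have "(\<lambda>a. \<Gamma> n #> a) ` A \<subseteq> rcosets (\<Gamma> n)"
        using Ac subgroup.subset[OF \<Gamma>(2)] by (auto intro: rcosetsI)
      then show "finite ((\<lambda>a. \<Gamma> n #> a) ` A)" using \<Gamma>(3) finite_subset by blast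
    qed (use C in blast)
    finally show "k \<le> card ((\<lambda>a. \<Gamma> n #> a) ` A)" .
  qed
qed

end

section \<open>The limit of the rank ratios\<close>

theorem theorem3:
  fixes G :: "('a, 'b) monoid_scheme" and \<Gamma> :: "nat \<Rightarrow> 'a set"
  assumes "group G"
    and "fin_generated G"
    and "\<exists>N. normal N G \<and> infinite N \<and> solvable (G\<lparr>carrier := N\<rparr>)"
    and "is_chain G \<Gamma>"
    and "(\<Inter>n. \<Gamma> n) = {\<one>\<^bsub>G\<^esub>}"
  shows "(\<lambda>n. rank_ratio G (\<Gamma> n)) \<longlonglongrightarrow> 0"
proof -
  interpret group G by fact
  have dec: "decseq \<Gamma>" and sub: "\<And>n. subgroup (\<Gamma> n) G" and fin: "\<And>n. finite (rcosets\<^bsub>G\<^esub> (\<Gamma> n))"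
    using assms(4) by (auto simp: is_chain_def decseq_Suc_iff)
  obtain N where N: "N \<lhd> G" "infinite N" "solvable (G\<lparr>carrier := N\<rparr>)"
    using assms(3) by blast
  obtain A where A: "A \<lhd> G" "infinite A" and
    comm: "\<forall>x\<in>A. \<forall>y\<in>A. x \<otimes>\<^bsub>G\<^esub> y = y \<otimes>\<^bsub>G\<^esub> x"
    using ex_infinite_abelian_normal[OF N dec sub fin assms(5)] .
  obtain Y where Y: "finite Y" "Y \<subseteq> carrier G" "generate G Y = carrier G"
    using assms(2) unfolding fin_generated_def by (elim exE conjE)
  define m where "m n = card ((\<lambda>a. \<Gamma> n #>\<^bsub>G\<^esub> a) ` A)" for n
  \<comment> \<open>The upper bound that remains once q has been cancelled. It depends on the chain
    only through \<open>m n\<close> and is of order log x / x.\<close>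
  define f where "f x = (2 * card Y * (1 + 2 * log 2 x) + log 2 x) / x" for x :: real
  have m_top: "filterlim (\<lambda>n. real (m n)) at_top sequentially"
    unfolding m_def
    by (rule filterlim_compose[OF filterlim_real_sequentially
        card_cosets_at_top[OF normal_imp_subgroup[OF A(1)] A(2) dec sub fin assms(5)]])
  have "(f \<longlongrightarrow> 0) at_top"
    unfolding f_def by real_asymp
  then have upper: "(\<lambda>n. f (m n)) \<longlonglongrightarrow> 0"
    using m_top by (rule filterlim_compose)
  \<comment> \<open>Since \<open>min_gens\<close> is a natural number, the numerator of the ratio is
    at least -1, while the index is at least \<open>m n\<close>. Squeezing from this side avoids a
    proof that the rank is positive.\<close>
  have lower: "(\<lambda>n. - inverse (real (m n))) \<longlonglongrightarrow> 0"
    using tendsto_minus[OF tendsto_inverse_0_at_top[OF m_top]] by simp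
  have bounds: "- inverse (real (m n)) \<le> rank_ratio G (\<Gamma> n) \<and> rank_ratio G (\<Gamma> n) \<le> f (m n)" for n
  proof -
    obtain q l where ql: "index G (\<Gamma> n) = q * m n" "2 ^ l \<le> m n"
      "min_gens G (\<Gamma> n) \<le> 2 * card Y * q * (1 + 2 * l) + l"
      using rank_bound_of_abelian_normal[OF Y A(1) comm[rule_format] sub[of n] fin[of n], folded m_def] .
    have "rcosets\<^bsub>G\<^esub> (\<Gamma> n) \<noteq> {}" by (auto simp: RCOSETS_def)
    then have "index G (\<Gamma> n) > 0" using fin by (simp add: index_def card_gt_0_iff)
    then have q: "q \<ge> 1" and m: "m n > 0" using ql(1) by (auto simp: Suc_le_eq)
    have "real l \<le> log 2 (real (m n))"
      using ql(2) m by (simp add: le_log_iff powr_realpow flip: of_nat_le_iff)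
    have "real (min_gens G (\<Gamma> n)) - 1 \<le> real (2 * card Y * q * (1 + 2 * l) + l)"
      using ql(3) by linarith
    \<comment> \<open>The summand l is enlarged to q l, using q \<ge> 1, so that q becomes a common
      factor and cancels against the index.\<close>
    also have "\<dots> \<le> q * (2 * card Y * (1 + 2 * real l) + real l)"
      using mult_right_mono[of 1 "real q" "real l"] q by (simp add: algebra_simps)
    also have "\<dots> \<le> q * (2 * card Y * (1 + 2 * log 2 (m n)) + log 2 (m n))"
      using \<open>real l \<le> log 2 (real (m n))\<close> by (intro mult_left_mono add_mono) auto
    finally have "rank_ratio G (\<Gamma> n)
        \<le> (q * (2 * card Y * (1 + 2 * log 2 (m n)) + log 2 (m n))) / (q * m n)"
      unfolding rank_ratio_def ql(1) of_nat_mult by (rule divide_right_mono) simp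
    also have "\<dots> = f (m n)" using q by (simp add: f_def)
    finally have "rank_ratio G (\<Gamma> n) \<le> f (m n)" .
    moreover have "- inverse (real (m n)) \<le> - 1 / (real q * real (m n))"
      using q m by (simp add: field_simps)
    moreover have "- 1 / (real q * real (m n)) \<le> rank_ratio G (\<Gamma> n)"
      unfolding rank_ratio_def ql(1) of_nat_mult by (rule divide_right_mono) simp_all
    ultimately show ?thesis by linarith
  qed
  show ?thesis
    by (rule tendsto_sandwich[OF _ _ lower upper]) (simp_all add: bounds)
qed

end
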